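(* If $\mathfrak{b}>\omega_1$, then $\nabla(\omega_1+1)^\omega$ is not hereditarily normal.
   Context: $\mathfrak{b}$ is the minimal size of an unbounded subset of $\omega^\omega$ under the mod-finite order $\leq^*$. The ordinal $\omega_1+1$ has the order topology. For a space $X$, the box product $\square X^\omega$ is $X^\omega$ with base all $\prod_nU_n$, $U_n$ open in $X$; $x\sim y$ iff $\{n:x(n)\ne y(n)\}$ is finite; $\nabla X^\omega$ is the quotient space $\square X^\omega/\sim$. A space is hereditarily normal if every subspace is normal. *)

theory Defs
  imports "HOL-Analysis.Analysis"
begin

unbundle cardinal_syntax

definition le_star :: "(nat \<Rightarrow> nat) \<Rightarrow> (nat \<Rightarrow> nat) \<Rightarrow> bool"  (infix \<open>\<le>*\<close> 50)
  where "f \<le>* g \<longleftrightarrow> finite {n. \<not> f n \<le> g n}"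

definition unbounded_star :: "(nat \<Rightarrow> nat) set \<Rightarrow> bool"
  where "unbounded_star B \<longleftrightarrow> \<not> (\<exists>g. \<forall>f\<in>B. f \<le>* g)"

text \<open>As usual for cardinals in HOL, the value is a cardinal order, determined up to \<open>=o\<close>.\<close>

definition bounding_number :: "(nat \<Rightarrow> nat) rel"
  where "bounding_number =
    (SOME r. \<exists>B. unbounded_star B \<and> r = |B| \<and> (\<forall>C. unbounded_star C \<longrightarrow> |B| \<le>o |C| ))"

lemma unbounded_star_UNIV: "unbounded_star UNIV"
proof -
  have "\<not> (\<lambda>n. Suc (g n)) \<le>* g" for g
    by (simp add: le_star_def)
  then show ?thesis
    unfolding unbounded_star_def by blast
qed

lemma bounding_number:
  shows "\<exists>B. unbounded_star B \<and> bounding_number = |B|"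
    and "unbounded_star C \<Longrightarrow> bounding_number \<le>o |C|"
proof -
  have "\<exists>r\<in>card_of ` Collect unbounded_star. \<forall>r'\<in>card_of ` Collect unbounded_star. r \<le>o r'"
    by (rule exists_minim_Card_order) (use unbounded_star_UNIV card_of_Card_order in blast)+
  then have "\<exists>r B. unbounded_star B \<and> r = |B| \<and> (\<forall>C. unbounded_star C \<longrightarrow> |B| \<le>o |C| )"
    by auto
  from someI_ex[OF this] have *: "\<exists>B. unbounded_star B \<and> bounding_number = |B| \<and>
      (\<forall>C. unbounded_star C \<longrightarrow> |B| \<le>o |C| )"
    unfolding bounding_number_def .
  show "\<exists>B. unbounded_star B \<and> bounding_number = |B|"
    and "unbounded_star C \<Longrightarrow> bounding_number \<le>o |C|"
    using * by auto
qed

definition omega1 :: "nat set rel"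
  where "omega1 = cardSuc natLeq"

text \<open>The ordinal successor of a well-order: \<open>None\<close> is added as the new largest element.\<close>

definition ord_succ :: "'a rel \<Rightarrow> 'a option rel"
  where "ord_succ r = {(Some a, Some b) |a b. (a, b) \<in> r} \<union> {(x, None) |x. x \<in> insert None (Some ` Field r)}"

lemma Field_ord_succ: "Field (ord_succ r) = insert None (Some ` Field r)"
proof
  show "Field (ord_succ r) \<subseteq> insert None (Some ` Field r)"
    by (auto simp: ord_succ_def Field_def)
  have "(x, None) \<in> ord_succ r" if "x \<in> insert None (Some ` Field r)" for x
    using that by (auto simp: ord_succ_def)
  then show "insert None (Some ` Field r) \<subseteq> Field (ord_succ r)"
    by (blast intro: FieldI1)
qed

lemma Well_order_omega1: "Well_order omega1"
  unfolding omega1_def using cardSuc_Card_order[OF natLeq_Card_order]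
  by (simp add: card_order_on_def)

lemma Well_order_ord_succ:
  assumes "Well_order r"
  shows "Well_order (ord_succ r)"
proof -
  have r: "Refl r" "trans r" "antisym r" "Total r" "wf (r - Id)"
    using assms by (auto simp: order_on_defs)
  have sub: "ord_succ r \<subseteq> Field (ord_succ r) \<times> Field (ord_succ r)"
    by (auto simp: Field_def)
  have refl: "Refl (ord_succ r)"
    unfolding refl_on_def Field_ord_succ
    using r(1) by (auto simp: ord_succ_def refl_on_def)
  have trans: "trans (ord_succ r)"
  proof (rule transI)
    fix x y z
    assume xy: "(x, y) \<in> ord_succ r" and yz: "(y, z) \<in> ord_succ r"
    show "(x, z) \<in> ord_succ r"
    proof (cases z)
      case None
      then show ?thesis
        using xy by (auto simp: ord_succ_def Field_def)
    next
      case (Some c)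
      then obtain b where b: "y = Some b" "(b, c) \<in> r"
        using yz by (auto simp: ord_succ_def)
      then obtain a where "x = Some a" "(a, b) \<in> r"
        using xy by (auto simp: ord_succ_def)
      then show ?thesis
        using b Some transD[OF r(2)] by (auto simp: ord_succ_def)
    qed
  qed
  have antisym: "antisym (ord_succ r)"
    using r(3) unfolding antisym_def ord_succ_def by auto
  have total: "Total (ord_succ r)"
    unfolding total_on_def Field_ord_succ
    using r(4) by (auto simp: ord_succ_def total_on_def)
  have "wf (ord_succ r - Id)"
  proof (rule wfUNIVI)
    fix P x
    assume step: "\<forall>x. (\<forall>y. (y, x) \<in> ord_succ r - Id \<longrightarrow> P y) \<longrightarrow> P x"
    have some: "P (Some a)" for a
      using r(5)
    proof (induction a rule: wf_induct_rule)
      case (less a)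
      have "P y" if "(y, Some a) \<in> ord_succ r - Id" for y
        using that less by (auto simp: ord_succ_def)
      then show ?case using step by blast
    qed
    moreover have "P None"
      using step[rule_format, of None] some by (metis DiffD2 IdI not_None_eq)
    ultimately show "P x" by (cases x) auto
  qed
  then show ?thesis
    using sub refl trans antisym total by (simp add: order_on_defs)
qed

text \<open>The open rays cover \<open>Field r\<close> unless it is a singleton, hence the extra generator.\<close>

definition order_topology_of :: "'a rel \<Rightarrow> 'a topology"
  where "order_topology_of r = topology_generated_by
    (insert (Field r) ((\<lambda>a. underS r a) ` Field r \<union> (\<lambda>a. aboveS r a) ` Field r))"

lemma topspace_order_topology_of [simp]: "topspace (order_topology_of r) = Field r"
  unfolding order_topology_of_def topology_generated_by_topspace
  by (auto simp: underS_def aboveS_def Field_def)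

definition omega1_plus_1 :: "nat set option topology"
  where "omega1_plus_1 = order_topology_of (ord_succ omega1)"

definition box_topology :: "('i \<Rightarrow> 'a topology) \<Rightarrow> 'i set \<Rightarrow> ('i \<Rightarrow> 'a) topology"
  where "box_topology T I =
    topology (arbitrary union_of (\<lambda>W. \<exists>U. (\<forall>i\<in>I. openin (T i) (U i)) \<and> W = (\<Pi>\<^sub>E i\<in>I. U i)))"

lemma openin_box_topology:
  "openin (box_topology T I) =
    arbitrary union_of (\<lambda>W. \<exists>U. (\<forall>i\<in>I. openin (T i) (U i)) \<and> W = (\<Pi>\<^sub>E i\<in>I. U i))"
proof -
  have "istopology (arbitrary union_of
      (\<lambda>W. \<exists>U. (\<forall>i\<in>I. openin (T i) (U i)) \<and> W = (\<Pi>\<^sub>E i\<in>I. U i)))"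
  proof (rule istopology_base)
    fix S S'
    assume "\<exists>U. (\<forall>i\<in>I. openin (T i) (U i)) \<and> S = (\<Pi>\<^sub>E i\<in>I. U i)"
      and "\<exists>U. (\<forall>i\<in>I. openin (T i) (U i)) \<and> S' = (\<Pi>\<^sub>E i\<in>I. U i)"
    then obtain U U' where "\<forall>i\<in>I. openin (T i) (U i)" "S = (\<Pi>\<^sub>E i\<in>I. U i)"
      "\<forall>i\<in>I. openin (T i) (U' i)" "S' = (\<Pi>\<^sub>E i\<in>I. U' i)"
      by blast
    then show "\<exists>U. (\<forall>i\<in>I. openin (T i) (U i)) \<and> S \<inter> S' = (\<Pi>\<^sub>E i\<in>I. U i)"
      by (intro exI[of _ "\<lambda>i. U i \<inter> U' i"]) (auto simp: PiE_Int)
  qed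
  then show ?thesis
    by (simp add: box_topology_def)
qed

lemma topspace_box_topology [simp]:
  "topspace (box_topology T I) = (\<Pi>\<^sub>E i\<in>I. topspace (T i))"
proof
  show "topspace (box_topology T I) \<subseteq> (\<Pi>\<^sub>E i\<in>I. topspace (T i))"
  proof
    fix x
    assume "x \<in> topspace (box_topology T I)"
    then have "(arbitrary union_of (\<lambda>W. \<exists>U. (\<forall>i\<in>I. openin (T i) (U i)) \<and> W = (\<Pi>\<^sub>E i\<in>I. U i)))
        (topspace (box_topology T I))"
      by (simp flip: openin_box_topology)
    with \<open>x \<in> topspace (box_topology T I)\<close>
    obtain U where U: "\<forall>i\<in>I. openin (T i) (U i)" and x: "x \<in> (\<Pi>\<^sub>E i\<in>I. U i)"
      unfolding arbitrary_union_of_alt by auto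
    have "(\<Pi>\<^sub>E i\<in>I. U i) \<subseteq> (\<Pi>\<^sub>E i\<in>I. topspace (T i))"
      using U by (intro PiE_mono openin_subset) blast
    then show "x \<in> (\<Pi>\<^sub>E i\<in>I. topspace (T i))"
      using x by (rule subsetD)
  qed
  have "openin (box_topology T I) (\<Pi>\<^sub>E i\<in>I. topspace (T i))"
    unfolding openin_box_topology by (intro arbitrary_union_of_inc exI[of _ "\<lambda>i. topspace (T i)"]) simp
  then show "(\<Pi>\<^sub>E i\<in>I. topspace (T i)) \<subseteq> topspace (box_topology T I)"
    by (rule openin_subset)
qed

definition quotient_topology :: "'a topology \<Rightarrow> 'a rel \<Rightarrow> 'a set topology"
  where "quotient_topology X r =
    topology (\<lambda>V. V \<subseteq> topspace X // r \<and> openin X {x \<in> topspace X. r `` {x} \<in> V})"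

lemma openin_quotient_topology:
  "openin (quotient_topology X r) V \<longleftrightarrow>
    V \<subseteq> topspace X // r \<and> openin X {x \<in> topspace X. r `` {x} \<in> V}"
proof -
  have "istopology (\<lambda>V. V \<subseteq> topspace X // r \<and> openin X {x \<in> topspace X. r `` {x} \<in> V})"
    unfolding istopology_def
  proof (intro conjI allI impI)
    fix S T
    assume S: "S \<subseteq> topspace X // r \<and> openin X {x \<in> topspace X. r `` {x} \<in> S}"
      and T: "T \<subseteq> topspace X // r \<and> openin X {x \<in> topspace X. r `` {x} \<in> T}"
    have "{x \<in> topspace X. r `` {x} \<in> S \<inter> T} =
        {x \<in> topspace X. r `` {x} \<in> S} \<inter> {x \<in> topspace X. r `` {x} \<in> T}"
      by auto
    then show "openin X {x \<in> topspace X. r `` {x} \<in> S \<inter> T}"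
      using S T by (simp add: openin_Int)
    show "S \<inter> T \<subseteq> topspace X // r" using S by blast
  next
    fix K
    assume K: "\<forall>S\<in>K. S \<subseteq> topspace X // r \<and> openin X {x \<in> topspace X. r `` {x} \<in> S}"
    have "{x \<in> topspace X. r `` {x} \<in> \<Union>K} = (\<Union>S\<in>K. {x \<in> topspace X. r `` {x} \<in> S})"
      by auto
    then show "openin X {x \<in> topspace X. r `` {x} \<in> \<Union>K}"
      using K by (simp only:) (rule openin_Union, auto)
    show "\<Union>K \<subseteq> topspace X // r" using K by blast
  qed
  then show ?thesis
    by (simp add: quotient_topology_def)
qed

lemma quotient_map_quotient_topology:
  "quotient_map X (quotient_topology X r) (\<lambda>x. r `` {x})"
proof -
  have "openin (quotient_topology X r) (topspace X // r)"
    by (simp add: openin_quotient_topology quotientI cong: conj_cong)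
  then have "topspace (quotient_topology X r) = topspace X // r"
    by (metis openin_quotient_topology openin_subset openin_topspace subset_antisym)
  then show ?thesis
    by (auto simp: quotient_map_def openin_quotient_topology quotient_def)
qed

definition nabla_rel :: "'a topology \<Rightarrow> (nat \<Rightarrow> 'a) rel"
  where "nabla_rel X = {(x, y). x \<in> topspace (box_topology (\<lambda>_. X) UNIV) \<and>
    y \<in> topspace (box_topology (\<lambda>_. X) UNIV) \<and> finite {n. x n \<noteq> y n}}"

lemma equiv_nabla_rel: "equiv (topspace (box_topology (\<lambda>_. X) UNIV)) (nabla_rel X)"
proof (rule equivI)
  show "nabla_rel X \<subseteq> topspace (box_topology (\<lambda>_. X) UNIV) \<times> topspace (box_topology (\<lambda>_. X) UNIV)"
    by (auto simp: nabla_rel_def)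
  show "refl_on (topspace (box_topology (\<lambda>_. X) UNIV)) (nabla_rel X)"
    by (simp add: refl_on_def nabla_rel_def)
  show "sym (nabla_rel X)"
    by (auto simp: sym_def nabla_rel_def eq_commute)
  show "trans (nabla_rel X)"
  proof (rule transI)
    fix x y z
    assume *: "(x, y) \<in> nabla_rel X" "(y, z) \<in> nabla_rel X"
    have "{n. x n \<noteq> z n} \<subseteq> {n. x n \<noteq> y n} \<union> {n. y n \<noteq> z n}"
      by auto
    then have "finite {n. x n \<noteq> z n}"
      by (rule finite_subset) (use * in \<open>simp add: nabla_rel_def\<close>)
    then show "(x, z) \<in> nabla_rel X"
      using * by (simp add: nabla_rel_def)
  qed
qed

definition nabla :: "'a topology \<Rightarrow> (nat \<Rightarrow> 'a) set topology"
  where "nabla X = quotient_topology (box_topology (\<lambda>_. X) UNIV) (nabla_rel X)"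

end

theory Submission
  imports Defs
begin

text \<open>Split the coordinates into even and odd ones. On the even coordinates, \<open>\<omega>\<^sub>1\<close> is the limit of
  \<open>\<omega>\<^sub>1\<close> many ordinals, uniformly with respect to any countably many neighbourhoods; on the odd ones,
  \<open>\<omega>\<close> is the limit of a sequence, and any \<open>\<omega>\<^sub>1\<close> many neighbourhoods of \<open>(\<omega>, \<omega>, \<dots>)\<close> have a common
  point in \<open>\<omega>\<^sup>\<omega>\<close> because \<open>\<omega>\<^sub>1\<close> is below the bounding number. So the nabla product contains a deleted
  plank with the corner \<open>(\<omega>\<^sub>1, \<omega>)\<close> removed, whose two edges cannot be separated.\<close>

section \<open>Nabla products\<close>

text \<open>For nonempty open \<open>U n\<close> this is the image of the box in the quotient.
  Asking for membership only eventually makes the condition independent of the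
  representative.\<close>

definition nabla_box :: "'a topology \<Rightarrow> (nat \<Rightarrow> 'a set) \<Rightarrow> (nat \<Rightarrow> 'a) set set"
  where "nabla_box T U =
    (\<lambda>x. nabla_rel T `` {x}) ` {x. (\<forall>n. x n \<in> topspace T) \<and> (\<forall>\<^sub>F n in sequentially. x n \<in> U n)}"

lemma nabla_rel_iff:
  "(x, y) \<in> nabla_rel T \<longleftrightarrow> (\<forall>n. x n \<in> topspace T) \<and> (\<forall>n. y n \<in> topspace T) \<and>
    (\<forall>\<^sub>F n in sequentially. x n = y n)"
  by (auto simp: nabla_rel_def PiE_UNIV_domain eventually_cofinite simp flip: cofinite_eq_sequentially)

lemma nabla_class_eq_iff:
  assumes "\<And>n. x n \<in> topspace T" "\<And>n. y n \<in> topspace T"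
  shows "nabla_rel T `` {x} = nabla_rel T `` {y} \<longleftrightarrow> (\<forall>\<^sub>F n in sequentially. x n = y n)"
  using eq_equiv_class_iff[OF equiv_nabla_rel[of T], of x y] assms
  by (simp add: nabla_rel_iff PiE_UNIV_domain)

text \<open>Representatives of one class agree at almost all coordinates, so the eventual condition
  can be tested on any of them.\<close>

lemma class_in_nabla_box_iff:
  assumes x: "\<And>n. x n \<in> topspace T"
  shows "nabla_rel T `` {x} \<in> nabla_box T U \<longleftrightarrow> (\<forall>\<^sub>F n in sequentially. x n \<in> U n)"
proof
  assume "nabla_rel T `` {x} \<in> nabla_box T U"
  then obtain y where y: "\<And>n. y n \<in> topspace T" "\<forall>\<^sub>F n in sequentially. y n \<in> U n"
    and "nabla_rel T `` {x} = nabla_rel T `` {y}"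
    unfolding nabla_box_def by auto
  then have "\<forall>\<^sub>F n in sequentially. x n = y n"
    using nabla_class_eq_iff[of x T y] x by blast
  with y(2) show "\<forall>\<^sub>F n in sequentially. x n \<in> U n"
    by eventually_elim simp
qed (use x in \<open>auto simp: nabla_box_def\<close>)

lemma openin_nabla_box:
  assumes U: "\<And>n. openin T (U n)"
  shows "openin (nabla T) (nabla_box T U)"
proof -
  let ?X = "box_topology (\<lambda>_. T) (UNIV :: nat set)"
  \<comment> \<open>\<open>?B N\<close> leaves the first \<open>N\<close> coordinates free; the
    preimage of \<open>nabla_box T U\<close> is the union of these open boxes.\<close>
  let ?B = "\<lambda>N. Pi\<^sub>E UNIV (\<lambda>n. if n < N then topspace T else U n)"
  have "{x \<in> topspace ?X. nabla_rel T `` {x} \<in> nabla_box T U} =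
      {x. (\<forall>n. x n \<in> topspace T) \<and> (\<forall>\<^sub>F n in sequentially. x n \<in> U n)}"
    by (auto simp: PiE_UNIV_domain Pi_iff class_in_nabla_box_iff)
  also have "\<dots> = (\<Union>N. ?B N)"
  proof (intro set_eqI iffI)
    fix x
    assume "x \<in> {x. (\<forall>n. x n \<in> topspace T) \<and> (\<forall>\<^sub>F n in sequentially. x n \<in> U n)}"
    then obtain N where "\<And>n. x n \<in> topspace T" "\<And>n. n \<ge> N \<Longrightarrow> x n \<in> U n"
      by (auto simp: eventually_sequentially)
    then have "x \<in> ?B N"
      by (simp add: PiE_UNIV_domain)
    then show "x \<in> (\<Union>N. ?B N)" by blast
  next
    fix x
    assume "x \<in> (\<Union>N. ?B N)"
    then obtain N where N: "\<And>n. x n \<in> (if n < N then topspace T else U n)"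
      by (auto simp: PiE_UNIV_domain Pi_iff)
    have "x n \<in> topspace T" for n
      using N[of n] openin_subset[OF U[of n]] by (auto split: if_splits)
    moreover have "x n \<in> U n" if "n \<ge> N" for n
      using N[of n] that by simp
    ultimately show "x \<in> {x. (\<forall>n. x n \<in> topspace T) \<and> (\<forall>\<^sub>F n in sequentially. x n \<in> U n)}"
      by (auto simp: eventually_sequentially)
  qed
  finally have eq: "{x \<in> topspace ?X. nabla_rel T `` {x} \<in> nabla_box T U} = (\<Union>N. ?B N)" .
  have "openin ?X (?B N)" for N
    unfolding openin_box_topology
    by (intro arbitrary_union_of_inc exI[of _ "\<lambda>n. if n < N then topspace T else U n"]) (simp add: U)
  then have "openin ?X (\<Union>N. ?B N)"
    by blast
  moreover have "nabla_box T U \<subseteq> topspace ?X // nabla_rel T"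
    by (auto simp: nabla_box_def quotient_def PiE_UNIV_domain)
  ultimately show ?thesis
    unfolding nabla_def openin_quotient_topology eq by blast
qed

text \<open>The preimage of \<open>W\<close> contains an open box around \<open>x\<close>. A point
  that is only eventually in this box can be moved into it by changing finitely many coordinates,
  which keeps its class.\<close>

lemma openin_nabla_contains_box:
  assumes W: "openin (nabla T) W" "nabla_rel T `` {x} \<in> W" and x: "\<And>n. x n \<in> topspace T"
  obtains U where "\<And>n. openin T (U n)" "\<And>n. x n \<in> U n" "nabla_box T U \<subseteq> W"
proof -
  let ?X = "box_topology (\<lambda>_. T) (UNIV :: nat set)"
  let ?P = "{y \<in> topspace ?X. nabla_rel T `` {y} \<in> W}"
  have "openin ?X ?P" "x \<in> ?P"
    using W x by (auto simp: nabla_def openin_quotient_topology PiE_UNIV_domain)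
  then have "\<exists>R. (\<exists>U. (\<forall>n\<in>UNIV. openin T (U n)) \<and> R = Pi\<^sub>E UNIV U) \<and> x \<in> R \<and> R \<subseteq> ?P"
    unfolding openin_box_topology arbitrary_union_of_alt by (rule bspec)
  then obtain U where U: "\<And>n. openin T (U n)" and "x \<in> Pi\<^sub>E UNIV U" "Pi\<^sub>E UNIV U \<subseteq> ?P"
    by blast
  then have xU: "\<And>n. x n \<in> U n" and sub: "\<And>y. (\<And>n. y n \<in> U n) \<Longrightarrow> y \<in> ?P"
    by (simp_all add: PiE_UNIV_domain Pi_iff subset_iff)
  have "nabla_rel T `` {y} \<in> W"
    if y: "\<And>n. y n \<in> topspace T" "\<forall>\<^sub>F n in sequentially. y n \<in> U n" for y
  proof -
    define z where "z n = (if y n \<in> U n then y n else x n)" for n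
    have z: "z \<in> ?P"
      by (rule sub) (simp add: z_def xU)
    have "\<forall>\<^sub>F n in sequentially. y n = z n"
      using y(2) by eventually_elim (simp add: z_def)
    then have "nabla_rel T `` {y} = nabla_rel T `` {z}"
      by (subst nabla_class_eq_iff) (use y x in \<open>auto simp: z_def\<close>)
    then show ?thesis using z by simp
  qed
  then have "nabla_box T U \<subseteq> W"
    by (auto simp: nabla_box_def)
  with U xU that show ?thesis by blast
qed

section \<open>The deleted plank in abstract form\<close>

text \<open>Isolates what the plank needs, with \<open>p\<close> as the long limit \<omega>1 and
  \<open>q\<close> as the limit of a sequence. \<open>P\<close> and \<open>Q\<close> exclude these
  limits, so that the corner falls outside the subspace under study.\<close>

lemma nabla_not_hereditarily_normal:
  fixes c :: "'i \<Rightarrow> 'a" and e :: "nat \<Rightarrow> 'a"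
  assumes P: "openin T P" "p \<in> topspace T - P" and Q: "openin T Q" "q \<in> topspace T - Q"
    and c: "\<And>i. i \<in> I \<Longrightarrow> c i \<in> P"
    and c_lim: "\<And>U :: nat \<Rightarrow> 'a set. (\<And>n. openin T (U n) \<and> p \<in> U n) \<Longrightarrow> \<exists>i\<in>I. \<forall>n. c i \<in> U n"
    and e: "\<And>k. e k \<in> Q"
    and e_lim: "\<And>U. openin T U \<Longrightarrow> q \<in> U \<Longrightarrow> \<forall>\<^sub>F k in sequentially. e k \<in> U"
    and bounded: "\<And>f. \<exists>g. \<forall>i\<in>I. f i \<le>* g"
  shows "\<not> hereditarily normal_space (nabla T)"
proof
  assume her: "hereditarily normal_space (nabla T)"
  define m where "m x s n = (if even n then x else s n)" for x :: 'a and s and n :: nat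
  define A where "A = nabla_box T (\<lambda>n. if even n then P else topspace T)"
  define B where "B = nabla_box T (\<lambda>n. if odd n then Q else topspace T)"
  \<comment> \<open>Both parities recur, so a fixed condition imposed on one parity cannot hold
    eventually if it fails there.\<close>
  have inf: "\<not> (\<forall>\<^sub>F n in sequentially. odd n)" "\<not> (\<forall>\<^sub>F n in sequentially. even n)"
    unfolding eventually_sequentially
    by (metis add.commute dvd_triv_left le_add1 mult_2, metis dvd_triv_left even_Suc le_SucI le_add1 mult_2)
  have sub: "P \<subseteq> topspace T" "Q \<subseteq> topspace T"
    using P Q by (auto dest: openin_subset)
  have m_top: "m x s n \<in> topspace T" if "x \<in> topspace T" "\<And>n. s n \<in> topspace T" for x s n
    using that by (simp add: m_def)
  have A: "openin (nabla T) A" and B: "openin (nabla T) B"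
    using P Q by (auto simp: A_def B_def intro!: openin_nabla_box)
  have mA: "nabla_rel T `` {m x s} \<in> A \<longleftrightarrow> x \<in> P"
    if "x \<in> topspace T" "\<And>n. s n \<in> topspace T" for x s
  proof -
    have "(\<lambda>n. m x s n \<in> (if even n then P else topspace T)) = (\<lambda>n. x \<in> P \<or> odd n)"
      using that by (auto simp: m_def)
    then show ?thesis
      unfolding A_def using inf by (cases "x \<in> P") (simp_all add: class_in_nabla_box_iff m_top that)
  qed
  have mB: "nabla_rel T `` {m x s} \<in> B \<longleftrightarrow> (\<forall>\<^sub>F n in sequentially. odd n \<longrightarrow> s n \<in> Q)"
    if "x \<in> topspace T" "\<And>n. s n \<in> topspace T" for x s
  proof -
    have "(\<lambda>n. m x s n \<in> (if odd n then Q else topspace T)) = (\<lambda>n. odd n \<longrightarrow> s n \<in> Q)"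
      using that by (auto simp: m_def)
    then show ?thesis
      unfolding B_def by (simp add: class_in_nabla_box_iff m_top that)
  qed
  \<comment> \<open>The corner, the class of \<open>m p (\<lambda>_. q)\<close>, lies in neither
    \<open>A\<close> nor \<open>B\<close>. Without it the two edges \<open>S - A\<close> and
    \<open>S - B\<close> are disjoint and relatively closed.\<close>
  define S where "S = A \<union> B"
  have S: "openin (nabla T) S"
    using A B by (auto simp: S_def)
  then have top: "topspace (subtopology (nabla T) S) = S"
    by (simp add: openin_subset topspace_subtopology_subset del: topspace_subtopology)
  have "closedin (subtopology (nabla T) S) (S - A)" "closedin (subtopology (nabla T) S) (S - B)"
    unfolding closedin_def top using A B S
    by (auto simp: S_def openin_open_subtopology double_diff)
  moreover have "disjnt (S - A) (S - B)"
    by (auto simp: S_def disjnt_def)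
  moreover have "normal_space (subtopology (nabla T) S)"
    using her S by (auto simp: hereditarily_def openin_subset)
  \<comment> \<open>As \<open>S\<close> is open, the separating sets are open in the whole nabla
    product and contain boxes around their points.\<close>
  ultimately obtain V U where V: "openin (nabla T) V" "S - A \<subseteq> V"
    and U: "openin (nabla T) U" "S - B \<subseteq> U" and "disjnt V U"
    unfolding normal_space_def by (metis S openin_open_subtopology)
  \<comment> \<open>A box inside \<open>U\<close> around the edge point of \<open>c i\<close> and
    \<open>q\<close> contains a tail of \<open>e\<close> at each odd coordinate; \<open>f\<close>
    records where these tails start. Domination modulo finite is enough because a nabla box ignores
    finitely many coordinates.\<close>
  have "\<exists>f. \<forall>g. (f \<le>* g) \<longrightarrow> nabla_rel T `` {m (c i) (e \<circ> g)} \<in> U" if i: "i \<in> I" for i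
  proof -
    have ci: "c i \<in> P" "c i \<in> topspace T"
      using c[OF i] sub by auto
    have "nabla_rel T `` {m (c i) (\<lambda>_. q)} \<in> S - B"
      using ci Q inf by (simp add: S_def mA mB)
    then have "nabla_rel T `` {m (c i) (\<lambda>_. q)} \<in> U"
      using U by blast
    then obtain O' where O': "\<And>n. openin T (O' n)" "\<And>n. m (c i) (\<lambda>_. q) n \<in> O' n" "nabla_box T O' \<subseteq> U"
      using openin_nabla_contains_box[OF U(1)] m_top ci Q by (metis DiffD1)
    \<comment> \<open>At even \<open>n\<close> the set \<open>O' n\<close> is a neighbourhood of
      \<open>c i\<close> rather than of \<open>q\<close>, hence the guard; \<open>f n\<close> is
      arbitrary there.\<close>
    have "\<exists>N. \<forall>k\<ge>N. odd n \<longrightarrow> e k \<in> O' n" for n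
      using e_lim[OF O'(1)[of n]] O'(2)[of n] by (cases "odd n") (auto simp: m_def eventually_sequentially)
    then obtain f where f: "\<And>n k. f n \<le> k \<Longrightarrow> odd n \<Longrightarrow> e k \<in> O' n"
      by metis
    have "nabla_rel T `` {m (c i) (e \<circ> g)} \<in> U" if "f \<le>* g" for g
    proof -
      have "\<forall>\<^sub>F n in sequentially. f n \<le> g n"
        using that by (simp add: le_star_def eventually_cofinite flip: cofinite_eq_sequentially)
      then have "\<forall>\<^sub>F n in sequentially. m (c i) (e \<circ> g) n \<in> O' n"
      proof eventually_elim
        case (elim n)
        then show ?case using f[of n "g n"] O'(2)[of n] by (auto simp: m_def)
      qed
      then have "nabla_rel T `` {m (c i) (e \<circ> g)} \<in> nabla_box T O'"
        by (subst class_in_nabla_box_iff) (use ci e sub in \<open>auto simp: m_def\<close>)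
      then show ?thesis using O' by blast
    qed
    then show ?thesis by blast
  qed
  then obtain f where f: "\<And>i g. i \<in> I \<Longrightarrow> f i \<le>* g \<Longrightarrow> nabla_rel T `` {m (c i) (e \<circ> g)} \<in> U"
    by metis
  \<comment> \<open>One \<open>g\<close> serves all \<open>i\<close> at once; its point
    \<open>m p (e \<circ> g)\<close> lies on the opposite edge, where \<open>V\<close> provides a
    box.\<close>
  obtain g where g: "\<And>i. i \<in> I \<Longrightarrow> f i \<le>* g"
    using bounded[of f] by blast
  have eg: "e (g n) \<in> topspace T" for n
    using e sub by blast
  have "nabla_rel T `` {m p (e \<circ> g)} \<in> S - A"
    using P eg e by (simp add: S_def mA mB)
  then have "nabla_rel T `` {m p (e \<circ> g)} \<in> V"
    using V by blast
  then obtain O' where O': "\<And>n. openin T (O' n)" "\<And>n. m p (e \<circ> g) n \<in> O' n" "nabla_box T O' \<subseteq> V"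
    by (rule openin_nabla_contains_box[OF V(1)]) (use P eg in \<open>auto simp: m_def\<close>)
  \<comment> \<open>The even coordinates of the box carry neighbourhoods of \<open>p\<close>;
    reindexed, they form the countable family for \<open>c_lim\<close>.\<close>
  have "openin T (O' (2 * n)) \<and> p \<in> O' (2 * n)" for n
    using O'(1,2)[of "2 * n"] by (simp add: m_def)
  from c_lim[of "\<lambda>n. O' (2 * n)", OF this]
  obtain i where i: "i \<in> I" "\<And>n. c i \<in> O' (2 * n)"
    by blast
  \<comment> \<open>Replacing \<open>p\<close> by \<open>c i\<close> keeps the point in the box
    inside \<open>V\<close>, while the choice of \<open>g\<close> puts it into
    \<open>U\<close>.\<close>
  have "m (c i) (e \<circ> g) n \<in> O' n" for n
    using i(2)[of "n div 2"] O'(2)[of n] by (auto simp: m_def)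
  then have "nabla_rel T `` {m (c i) (e \<circ> g)} \<in> nabla_box T O'"
    by (subst class_in_nabla_box_iff) (use c[OF i(1)] sub eg in \<open>auto simp: m_def\<close>)
  then show False
    using f[OF i(1) g[OF i(1)]] O' \<open>disjnt V U\<close> by (auto simp: disjnt_def)
qed

section \<open>The order topology of \<open>\<omega>\<^sub>1 + 1\<close>\<close>

text \<open>Induction on the generation of \<open>U\<close> from the subbase. The filter is
  arbitrary in order to cover both sequences and tails of \<open>omega1\<close>.\<close>

lemma eventually_in_topology_generated_by:
  assumes U: "openin (topology_generated_by S) U" and "x \<in> U"
    and S: "\<And>G. G \<in> S \<Longrightarrow> x \<in> G \<Longrightarrow> \<forall>\<^sub>F i in F. f i \<in> G"
  shows "\<forall>\<^sub>F i in F. f i \<in> U"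
proof -
  have "generate_topology_on S U"
    using U by (simp add: openin_topology_generated_by_iff)
  then show ?thesis
    using \<open>x \<in> U\<close>
  proof (induction)
    case (Int a b)
    then show ?case by (auto simp: eventually_conj_iff)
  next
    case (UN K)
    then obtain k where "k \<in> K" "\<forall>\<^sub>F i in F. f i \<in> k" by blast
    then show ?case by (auto elim!: eventually_mono)
  qed (use S in auto)
qed

text \<open>The rays through \<open>x\<close> are the subbasic sets to test; the last assumption
  handles the extra generator \<open>Field r\<close>.\<close>

lemma eventually_in_order_topology:
  assumes "openin (order_topology_of r) U" "x \<in> U"
    and "\<And>a. a \<in> Field r \<Longrightarrow> x \<in> underS r a \<Longrightarrow> \<forall>\<^sub>F i in F. f i \<in> underS r a"
    and "\<And>a. a \<in> Field r \<Longrightarrow> x \<in> aboveS r a \<Longrightarrow> \<forall>\<^sub>F i in F. f i \<in> aboveS r a"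
    and "\<forall>\<^sub>F i in F. f i \<in> Field r"
  shows "\<forall>\<^sub>F i in F. f i \<in> U"
  using assms(1,2) unfolding order_topology_of_def
  by (rule eventually_in_topology_generated_by) (use assms(3-5) in auto)

lemma openin_underS: "a \<in> Field r \<Longrightarrow> openin (order_topology_of r) (underS r a)"
  unfolding order_topology_of_def by (auto intro!: topology_generated_by_Basis)

section \<open>Countable bounds and limits in \<open>omega1\<close>\<close>

lemma card_order_omega1: "Card_order omega1"
  unfolding omega1_def by (rule cardSuc_Card_order[OF natLeq_Card_order])

lemma omega1_total: "a \<in> Field omega1 \<Longrightarrow> b \<in> Field omega1 \<Longrightarrow> (a, b) \<in> omega1 \<or> (b, a) \<in> omega1"
  using wo_rel.TOTALS[of omega1] Well_order_omega1 by (simp add: wo_rel_def)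

lemma infinite_omega1: "infinite (Field omega1)"
  unfolding omega1_def using cardSuc_finite[OF natLeq_Card_order] by (simp add: Field_natLeq)

text \<open>The successor of an infinite cardinal is regular, so a countable subset is not
  cofinal.\<close>

lemma omega1_bound:
  fixes b :: "nat \<Rightarrow> nat set"
  assumes b: "\<And>n. b n \<in> Field omega1"
  obtains a where "a \<in> Field omega1" "\<And>n. (b n, a) \<in> omega1" "\<And>n. b n \<noteq> a"
proof -
  have "regularCard omega1"
    unfolding omega1_def by (rule infinite_cardSuc_regularCard) (use natLeq_Card_order in \<open>simp_all only: Field_natLeq infinite_UNIV_nat not_False_eq_True\<close>)
  have "\<not> |range b| =o omega1"
  proof
    assume "|range b| =o omega1"
    moreover have "|range b| \<le>o natLeq"
      using card_of_image[of b UNIV] card_of_nat ordLeq_ordIso_trans by blast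
    ultimately have "omega1 \<le>o natLeq"
      by (meson ordIso_symmetric ordIso_ordLeq_trans)
    then show False
      unfolding omega1_def using cardSuc_greater[OF natLeq_Card_order] not_ordLeq_ordLess by blast
  qed
  then have "\<not> cofinal (range b) omega1"
    using \<open>regularCard omega1\<close> b unfolding regularCard_def by blast
  then obtain a where a: "a \<in> Field omega1" "\<And>n. a = b n \<or> (a, b n) \<notin> omega1"
    unfolding cofinal_def by blast
  have lin: "trans omega1" "antisym omega1"
    using Well_order_omega1 by (auto simp: order_on_defs)
  have le: "(b n, a) \<in> omega1" for n
    using a(2)[of n] omega1_total[OF b a(1), of n] by auto
  \<comment> \<open>Non-cofinality gives only a weak bound \<open>a\<close>; moving up to a larger
    \<open>a'\<close> makes it strict.\<close>
  obtain a' where a': "a' \<in> Field omega1" "a \<noteq> a'" "(a, a') \<in> omega1"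
    using infinite_Card_order_limit[OF card_order_omega1 infinite_omega1 a(1)] by blast
  have "(b n, a') \<in> omega1" "b n \<noteq> a'" for n
    using le[of n] a' lin by (meson transD, metis antisymD)
  with a' that show ?thesis by blast
qed

text \<open>\<open>w\<close> is the least strict upper bound of a strictly increasing sequence. It
  takes the place of \<omega>, but may be any ordinal that arises in this way.\<close>

lemma omega1_limit:
  obtains w :: "nat set" and e :: "nat \<Rightarrow> nat set" where "w \<in> Field omega1"
    "\<And>n. (e n, w) \<in> omega1" "\<And>n. e n \<noteq> w"
    "\<And>b. (b, w) \<in> omega1 \<Longrightarrow> b \<noteq> w \<Longrightarrow> \<forall>\<^sub>F n in sequentially. (b, e n) \<in> omega1 \<and> b \<noteq> e n"
proof -
  have lin: "trans omega1" "antisym omega1" "wf (omega1 - Id)"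
    using Well_order_omega1 by (auto simp: order_on_defs)
  obtain a0 where a0: "a0 \<in> Field omega1"
    using infinite_omega1 by fastforce
  have "\<exists>e :: nat \<Rightarrow> nat set. \<forall>n. e n \<in> Field omega1 \<and> (e n \<noteq> e (Suc n) \<and> (e n, e (Suc n)) \<in> omega1)"
    by (rule dependent_nat_choice)
      (use a0 infinite_Card_order_limit[OF card_order_omega1 infinite_omega1] in blast)+
  then obtain e :: "nat \<Rightarrow> nat set" where e: "\<And>n. e n \<in> Field omega1" "\<And>n. e n \<noteq> e (Suc n)"
    "\<And>n. (e n, e (Suc n)) \<in> omega1"
    by blast
  define B where "B = {a \<in> Field omega1. \<forall>n. (e n, a) \<in> omega1 \<and> e n \<noteq> a}"
  obtain u where "u \<in> Field omega1" "\<And>n. (e n, u) \<in> omega1" "\<And>n. e n \<noteq> u"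
    using omega1_bound[of e] e(1) by blast
  then have "B \<noteq> {}"
    by (auto simp: B_def)
  then obtain w where w: "w \<in> B" "\<And>b. (b, w) \<in> omega1 - Id \<Longrightarrow> b \<notin> B"
    using wfE_min'[OF lin(3)] by blast
  have "\<forall>\<^sub>F n in sequentially. (b, e n) \<in> omega1 \<and> b \<noteq> e n" if b: "(b, w) \<in> omega1" "b \<noteq> w" for b
  proof -
    have "b \<in> Field omega1" "b \<notin> B"
      using b w(2) by (auto intro: FieldI1)
    \<comment> \<open>Being below the least strict upper bound, \<open>b\<close> is at or below some
      \<open>e n\<close>; strictness holds from \<open>Suc n\<close> on.\<close>
    then obtain n where "(e n, b) \<notin> omega1 \<or> e n = b"
      by (auto simp: B_def)
    then have "(b, e n) \<in> omega1"
      using omega1_total[OF \<open>b \<in> Field omega1\<close> e(1)[of n]] by auto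
    have step: "(b, e (Suc k)) \<in> omega1 \<and> b \<noteq> e (Suc k)" if "(b, e k) \<in> omega1" for k
      using that e(2,3)[of k] lin(1,2) by (metis antisymD transD)
    have "(b, e k) \<in> omega1 \<and> b \<noteq> e k" if "k \<ge> Suc n" for k
      using that by (induction rule: dec_induct) (use step \<open>(b, e n) \<in> omega1\<close> in auto)
    then show ?thesis
      unfolding eventually_sequentially by blast
  qed
  with w(1) that show ?thesis
    unfolding B_def by blast
qed

section \<open>Tails of \<open>omega1\<close>\<close>

text \<open>Plays for convergence to the top point \<open>None\<close> the role that
  \<open>sequentially\<close> plays for sequences.\<close>

definition omega1_filter :: "nat set filter"
  where "omega1_filter = (INF a\<in>Field omega1. principal (aboveS omega1 a))"

text \<open>By totality the tails form a chain, so they are a base of the filter.\<close>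

lemma eventually_omega1_filter:
  "eventually P omega1_filter \<longleftrightarrow> (\<exists>a\<in>Field omega1. \<forall>b\<in>aboveS omega1 a. P b)"
proof -
  have lin: "trans omega1" "antisym omega1"
    using Well_order_omega1 by (auto simp: order_on_defs)
  have anti: "aboveS omega1 b \<subseteq> aboveS omega1 a" if "(a, b) \<in> omega1" for a b
    using that lin unfolding aboveS_def by (auto dest: transD antisymD)
  have "\<exists>x\<in>Field omega1. principal (aboveS omega1 x) \<le>
      inf (principal (aboveS omega1 a)) (principal (aboveS omega1 b))"
    if ab: "a \<in> Field omega1" "b \<in> Field omega1" for a b
  proof -
    consider "(a, b) \<in> omega1" | "(b, a) \<in> omega1"
      using omega1_total[OF ab] by blast
    then show ?thesis
      using anti ab by cases (auto simp: le_inf_iff)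
  qed
  moreover have "Field omega1 \<noteq> {}"
    using infinite_omega1 by auto
  ultimately show ?thesis
    unfolding omega1_filter_def by (subst eventually_INF_base) (auto simp: eventually_principal)
qed

text \<open>Countably many tails have a common element, namely a strict bound of their starting
  points.\<close>

lemma omega1_filter_countable:
  fixes P :: "nat \<Rightarrow> nat set \<Rightarrow> bool"
  assumes "\<And>n. eventually (P n) omega1_filter"
  shows "\<exists>a\<in>Field omega1. \<forall>n. P n a"
proof -
  obtain b where b: "\<And>n. b n \<in> Field omega1" "\<And>n a. a \<in> aboveS omega1 (b n) \<Longrightarrow> P n a"
    using assms unfolding eventually_omega1_filter by metis
  obtain a where "a \<in> Field omega1" "\<And>n. (b n, a) \<in> omega1" "\<And>n. b n \<noteq> a"
    using omega1_bound[of b] b(1) by blast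
  moreover from this have "P n a" for n
    using b(2)[of a n] by (auto simp: aboveS_def)
  ultimately show ?thesis
    by blast
qed

text \<open>The image of the index set has cardinality at most \<open>r\<close>, too small for an
  unbounded family.\<close>

lemma bounded_below_bounding_number:
  assumes "r <o bounding_number" and "Card_order r"
  shows "\<exists>g. \<forall>i\<in>Field r. f i \<le>* g"
proof (rule ccontr)
  assume "\<nexists>g. \<forall>i\<in>Field r. f i \<le>* g"
  then have "unbounded_star (f ` Field r)"
    by (simp add: unbounded_star_def)
  then have "bounding_number \<le>o |f ` Field r|"
    by (rule bounding_number)
  also have "|f ` Field r| \<le>o |Field r|"
    by (rule card_of_image)
  also have "|Field r| =o r"
    using assms(2) by (rule card_of_Field_ordIso)
  finally show False
    using assms(1) not_ordLess_ordLeq by blast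
qed

theorem theorem35:
  assumes "omega1 <o bounding_number"
  shows "\<not> hereditarily normal_space (nabla omega1_plus_1)"
proof -
  let ?r = "ord_succ omega1"
  have lin: "antisym omega1" "trans omega1"
    using Well_order_omega1 by (auto simp: order_on_defs)
  obtain w :: "nat set" and e :: "nat \<Rightarrow> nat set" where w: "w \<in> Field omega1"
    and e: "\<And>n. (e n, w) \<in> omega1" "\<And>n. e n \<noteq> w"
    and e_lim: "\<And>b. (b, w) \<in> omega1 \<Longrightarrow> b \<noteq> w \<Longrightarrow>
      \<forall>\<^sub>F n in sequentially. (b, e n) \<in> omega1 \<and> b \<noteq> e n"
    by (rule omega1_limit) blast
  have eF: "e n \<in> Field omega1" for n
    using e(1) by (rule FieldI1)
  \<comment> \<open>Every ray \<open>aboveS ?r a\<close> around the top point \<open>None\<close>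
    starts at some \<open>Some b\<close> and so contains a tail; no ray \<open>underS ?r a\<close>
    contains \<open>None\<close>.\<close>
  have Some_lim: "\<forall>\<^sub>F a in omega1_filter. Some a \<in> U" if "openin omega1_plus_1 U" "None \<in> U" for U
    using that unfolding omega1_plus_1_def
  proof (rule eventually_in_order_topology)
    fix a assume "a \<in> Field ?r" "None \<in> aboveS ?r a"
    then obtain b where "a = Some b" "b \<in> Field omega1"
      by (auto simp: Field_ord_succ aboveS_def)
    then show "\<forall>\<^sub>F i in omega1_filter. Some i \<in> aboveS ?r a"
      unfolding eventually_omega1_filter by (auto simp: aboveS_def ord_succ_def)
  next
    have "Field omega1 \<noteq> {}"
      using w by blast
    then show "\<forall>\<^sub>F i in omega1_filter. Some i \<in> Field ?r"
      unfolding eventually_omega1_filter by (auto simp: aboveS_def Field_ord_succ intro: FieldI2)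
  qed (auto simp: underS_def ord_succ_def)
  \<comment> \<open>Lower rays around \<open>Some w\<close> contain the whole sequence, upper rays
    contain a tail of it by the choice of \<open>w\<close>.\<close>
  have e_conv: "\<forall>\<^sub>F k in sequentially. Some (e k) \<in> U" if "openin omega1_plus_1 U" "Some w \<in> U" for U
    using that unfolding omega1_plus_1_def
  proof (rule eventually_in_order_topology)
    fix a assume "a \<in> Field ?r" "Some w \<in> underS ?r a"
    then have "Some (e k) \<in> underS ?r a" for k
      using e[of k] eF[of k] lin by (auto simp: underS_def ord_succ_def dest: antisymD transD)
    then show "\<forall>\<^sub>F k in sequentially. Some (e k) \<in> underS ?r a"
      by simp
  next
    fix a assume "a \<in> Field ?r" "Some w \<in> aboveS ?r a"
    then obtain b where b: "a = Some b" "(b, w) \<in> omega1" "b \<noteq> w"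
      by (auto simp: aboveS_def ord_succ_def)
    from e_lim[OF b(2,3)] show "\<forall>\<^sub>F k in sequentially. Some (e k) \<in> aboveS ?r a"
      by eventually_elim (auto simp: b(1) aboveS_def ord_succ_def)
  qed (simp add: Field_ord_succ eF)
  \<comment> \<open>\<open>P\<close> is the copy of \<omega>1 and \<open>Q\<close> the interval of
    ordinals below \<open>w\<close>: open initial segments that miss their limits.\<close>
  show ?thesis
  proof (rule nabla_not_hereditarily_normal[where P = "underS ?r None" and p = None
      and Q = "underS ?r (Some w)" and q = "Some w" and I = "Field omega1" and c = Some
      and e = "\<lambda>n. Some (e n)"])
    show "openin omega1_plus_1 (underS ?r None)" "openin omega1_plus_1 (underS ?r (Some w))"
      using w by (auto simp: omega1_plus_1_def Field_ord_succ intro: openin_underS)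
    show "None \<in> topspace omega1_plus_1 - underS ?r None"
      "Some w \<in> topspace omega1_plus_1 - underS ?r (Some w)"
      using w by (auto simp: omega1_plus_1_def Field_ord_succ underS_def)
    show "Some i \<in> underS ?r None" if "i \<in> Field omega1" for i
      using that by (simp add: underS_def ord_succ_def)
    show "Some (e k) \<in> underS ?r (Some w)" for k
      using e by (simp add: underS_def ord_succ_def)
    show "\<exists>i\<in>Field omega1. \<forall>n. Some i \<in> U n"
      if "\<And>n. openin omega1_plus_1 (U n) \<and> None \<in> U n" for U :: "nat \<Rightarrow> nat set option set"
      by (rule omega1_filter_countable) (use Some_lim that in blast)
    show "\<exists>g. \<forall>i\<in>Field omega1. f i \<le>* g" for f
      using assms card_order_omega1 by (intro bounded_below_bounding_number) auto
  qed (rule e_conv)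
qed

end
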